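(* Let $V$ be a $k$-vector space, let $\varphi\in\operatorname{End}_k(V)$, and assume that the localization morphism $\phi\colon V\to V_x$ is surjective. Then $\phi$ admits a (unique) section of $k[x]$-modules, i.e. a $k[x]$-linear map $\sigma\colon V_x\to V$ with $\phi\circ\sigma=\operatorname{Id}_{V_x}$, if and only if $\varphi$ can be written as a sum $\varphi=\varphi_1+\varphi_2$ with $\varphi_1,\varphi_2\in\operatorname{End}_k(V)$ satisfying: \begin{itemize} \item $i(\varphi_1)\leq 1$; \item $\varphi_2$ is pointwise nilpotent; \item $\varphi_1\circ\varphi_2=0=\varphi_2\circ\varphi_1$. \end{itemize}
   Context: $k$ is a field and $V$ is an arbitrary (possibly infinite-dimensional) $k$-vector space. The endomorphism $\varphi$ makes $V$ a $k[x]$-module via $x\cdot v:=\varphi(v)$. $V_x$ denotes the localization of the $k[x]$-module $V$ at the multiplicative system $S_x=\{1,x,x^2,\dots\}$, and $\phi\colon V\to V_x$, $v\mapsto v/1$, is the localization morphism. The index $i(f)$ of $f\in\operatorname{End}_k(V)$ is $0$ if $f$ is an automorphism; otherwise it is the smallest positive integer $m$ (if one exists) such that $\operatorname{Ker}(f^m)=\operatorname{Ker}(f^{m+1})$ and $\operatorname{Im}(f^m)=\operatorname{Im}(f^{m+1})$; "$i(f)\le 1$" means that the index exists and is at most $1$. An endomorphism $f\in\operatorname{End}_k(V)$ is pointwise nilpotent if each $v\in V$ is annihilated by some power $f^{n(v)}$ with $n(v)\in\mathbb{N}$ (equivalently, the localization at $S_x$ of $V$ with the $k[x]$-module structure given by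 $f$ is zero).
   Formalization: The parenthetical "(unique)" is dropped and only existence of a section is claimed: sections need not be unique, e.g. V = k((x)) ⊕ k((x))/k[[x]] with φ multiplication by x has the two sections f ↦ (f,0) and f ↦ (f,[f]). *)

theory Defs
  imports "HOL-Computational_Algebra.Polynomial" "HOL-Library.Extended_Nat"
begin

section \<open>Localization of a module at a multiplicative set\<close>

text \<open>
  The module is the whole type \<open>'m\<close>, with scalar multiplication \<open>scale\<close> of the
  commutative ring \<open>'r\<close>.  Since the localization depends on \<open>scale\<close> and \<open>S\<close>, it is not a
  type but the set of equivalence classes of pairs \<open>(m, s)\<close> (standing for \<open>m/s\<close>) under
  \<open>(m, s) \<sim> (n, t) \<longleftrightarrow> (\<exists>u\<in>S. u(tm - sn) = 0)\<close>.
\<close>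

definition loc_rel ::
    "('r::comm_ring_1 \<Rightarrow> 'm::ab_group_add \<Rightarrow> 'm) \<Rightarrow> 'r set \<Rightarrow> (('m \<times> 'r) \<times> ('m \<times> 'r)) set" where
  "loc_rel scale S =
     {((m, s), (n, t)). s \<in> S \<and> t \<in> S \<and> (\<exists>u\<in>S. scale u (scale t m - scale s n) = 0)}"

definition loc_carrier ::
    "('r::comm_ring_1 \<Rightarrow> 'm::ab_group_add \<Rightarrow> 'm) \<Rightarrow> 'r set \<Rightarrow> ('m \<times> 'r) set set" where
  "loc_carrier scale S = (UNIV \<times> S) // loc_rel scale S"

definition loc_frac ::
    "('r::comm_ring_1 \<Rightarrow> 'm::ab_group_add \<Rightarrow> 'm) \<Rightarrow> 'r set \<Rightarrow> 'm \<Rightarrow> 'r \<Rightarrow> ('m \<times> 'r) set" where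
  "loc_frac scale S m s = loc_rel scale S `` {(m, s)}"

definition loc_add ::
    "('r::comm_ring_1 \<Rightarrow> 'm::ab_group_add \<Rightarrow> 'm) \<Rightarrow> 'r set
      \<Rightarrow> ('m \<times> 'r) set \<Rightarrow> ('m \<times> 'r) set \<Rightarrow> ('m \<times> 'r) set" where
  "loc_add scale S A B =
     (\<Union>(m, s)\<in>A. \<Union>(n, t)\<in>B. loc_frac scale S (scale t m + scale s n) (s * t))"

definition loc_scale ::
    "('r::comm_ring_1 \<Rightarrow> 'm::ab_group_add \<Rightarrow> 'm) \<Rightarrow> 'r set
      \<Rightarrow> 'r \<Rightarrow> ('m \<times> 'r) set \<Rightarrow> ('m \<times> 'r) set" where
  "loc_scale scale S r A = (\<Union>(m, s)\<in>A. loc_frac scale S (scale r m) s)"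

definition loc_map ::
    "('r::comm_ring_1 \<Rightarrow> 'm::ab_group_add \<Rightarrow> 'm) \<Rightarrow> 'r set \<Rightarrow> 'm \<Rightarrow> ('m \<times> 'r) set" where
  "loc_map scale S m = loc_frac scale S m 1"

text \<open>A section of \<open>loc_map\<close> only matters on \<open>loc_carrier\<close>; its values elsewhere are unconstrained.\<close>

definition loc_section ::
    "('r::comm_ring_1 \<Rightarrow> 'm::ab_group_add \<Rightarrow> 'm) \<Rightarrow> 'r set \<Rightarrow> (('m \<times> 'r) set \<Rightarrow> 'm) \<Rightarrow> bool" where
  "loc_section scale S \<sigma> \<longleftrightarrow>
     (\<forall>A\<in>loc_carrier scale S. \<forall>B\<in>loc_carrier scale S. \<sigma> (loc_add scale S A B) = \<sigma> A + \<sigma> B) \<and>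
     (\<forall>r. \<forall>A\<in>loc_carrier scale S. \<sigma> (loc_scale scale S r A) = scale r (\<sigma> A)) \<and>
     (\<forall>A\<in>loc_carrier scale S. loc_map scale S (\<sigma> A) = A)"

text \<open>The relation is an equivalence, and the operations are well defined on classes.\<close>

locale module_mult_set = module scale
  for scale :: "'r::comm_ring_1 \<Rightarrow> 'm::ab_group_add \<Rightarrow> 'm" +
  fixes S :: "'r set"
  assumes one_closed: "1 \<in> S"
    and mult_closed: "s \<in> S \<Longrightarrow> t \<in> S \<Longrightarrow> s * t \<in> S"
begin

lemma loc_rel_iff:
  "((m, s), (n, t)) \<in> loc_rel scale S \<longleftrightarrow>
     s \<in> S \<and> t \<in> S \<and> (\<exists>u\<in>S. scale (u * t) m = scale (u * s) n)"
  by (auto simp: loc_rel_def scale_right_diff_distrib)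

lemma equiv_loc_rel: "equiv (UNIV \<times> S) (loc_rel scale S)"
proof (rule equivI)
  show "loc_rel scale S \<subseteq> (UNIV \<times> S) \<times> (UNIV \<times> S)"
    by (auto simp: loc_rel_def)
  show "refl_on (UNIV \<times> S) (loc_rel scale S)"
    using one_closed by (auto simp: refl_on_def loc_rel_iff)
  show "sym (loc_rel scale S)"
    unfolding sym_def by (auto simp: loc_rel_iff) metis
  show "trans (loc_rel scale S)"
  proof (rule transI, clarify)
    fix m s n t k w
    assume "((m, s), (n, t)) \<in> loc_rel scale S" "((n, t), (k, w)) \<in> loc_rel scale S"
    then obtain u v where S: "s \<in> S" "t \<in> S" "w \<in> S" "u \<in> S" "v \<in> S"
      and 1: "scale (u * t) m = scale (u * s) n" and 2: "scale (v * w) n = scale (v * t) k"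
      by (auto simp: loc_rel_iff)
    have "scale (u * v * t * w) m = scale (v * w) (scale (u * t) m)"
      by (simp add: mult_ac)
    also have "\<dots> = scale (u * s) (scale (v * w) n)"
      unfolding 1 by (simp add: mult_ac)
    also have "\<dots> = scale (u * v * t * s) k"
      unfolding 2 by (simp add: mult_ac)
    finally show "((m, s), (k, w)) \<in> loc_rel scale S"
      using S mult_closed by (auto simp: loc_rel_iff intro!: bexI[of _ "u * v * t"])
  qed
qed

lemma loc_frac_in_carrier: "s \<in> S \<Longrightarrow> loc_frac scale S m s \<in> loc_carrier scale S"
  by (auto simp: loc_frac_def loc_carrier_def intro: quotientI)

lemma loc_carrier_cases:
  assumes "A \<in> loc_carrier scale S"
  obtains m s where "s \<in> S" "A = loc_frac scale S m s"
  using assms by (auto simp: loc_frac_def loc_carrier_def elim: quotientE)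

lemma loc_frac_eq_iff:
  assumes "s \<in> S" "t \<in> S"
  shows "loc_frac scale S m s = loc_frac scale S n t \<longleftrightarrow>
    (\<exists>u\<in>S. scale (u * t) m = scale (u * s) n)"
  using eq_equiv_class_iff[OF equiv_loc_rel, of "(m, s)" "(n, t)"] assms
  by (simp add: loc_frac_def loc_rel_iff)

lemma loc_scale_frac:
  assumes "s \<in> S"
  shows "loc_scale scale S r (loc_frac scale S m s) = loc_frac scale S (scale r m) s"
proof -
  have "(\<lambda>(m, s). loc_frac scale S (scale r m) s) respects loc_rel scale S"
  proof (rule congruentI, clarify)
    fix m s n t
    assume "((m, s), (n, t)) \<in> loc_rel scale S"
    then obtain u where u: "s \<in> S" "t \<in> S" "u \<in> S" "scale (u * t) m = scale (u * s) n"
      by (auto simp: loc_rel_iff)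
    have "scale (u * t) (scale r m) = scale r (scale (u * t) m)" by (simp add: mult_ac)
    also have "\<dots> = scale (u * s) (scale r n)" unfolding u(4) by (simp add: mult_ac)
    finally show "loc_frac scale S (scale r m) s = loc_frac scale S (scale r n) t"
      using u by (auto simp: loc_frac_eq_iff)
  qed
  from UN_equiv_class[OF equiv_loc_rel this, of "(m, s)"] assms show ?thesis
    by (simp add: loc_scale_def loc_frac_def[of _ _ m s])
qed

lemma loc_add_frac:
  assumes "s \<in> S" "t \<in> S"
  shows "loc_add scale S (loc_frac scale S m s) (loc_frac scale S n t) =
    loc_frac scale S (scale t m + scale s n) (s * t)"
proof -
  have "(\<lambda>(m, s) (n, t). loc_frac scale S (scale t m + scale s n) (s * t))
          respects2 loc_rel scale S"
  proof (rule congruent2I', clarify)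
    fix m s m' s' n t n' t'
    assume "((m, s), (m', s')) \<in> loc_rel scale S" "((n, t), (n', t')) \<in> loc_rel scale S"
    then obtain u v where S: "s \<in> S" "s' \<in> S" "t \<in> S" "t' \<in> S" "u \<in> S" "v \<in> S"
      and 1: "scale (u * s') m = scale (u * s) m'" and 2: "scale (v * t') n = scale (v * t) n'"
      by (auto simp: loc_rel_iff)
    have "scale (u * v * (s' * t')) (scale t m + scale s n) =
        scale (v * t * t') (scale (u * s') m) + scale (u * s * s') (scale (v * t') n)"
      by (simp add: scale_right_distrib mult_ac)
    also have "\<dots> = scale (u * v * (s * t)) (scale t' m' + scale s' n')"
      unfolding 1 2 by (simp add: scale_right_distrib mult_ac)
    finally show "loc_frac scale S (scale t m + scale s n) (s * t) =
        loc_frac scale S (scale t' m' + scale s' n') (s' * t')"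
      using S mult_closed by (subst loc_frac_eq_iff) (auto intro!: bexI[of _ "u * v"])
  qed
  from UN_equiv_class2[OF equiv_loc_rel equiv_loc_rel this, of "(m, s)" "(n, t)"] assms
  show ?thesis
    by (simp add: loc_add_def loc_frac_def[of _ _ m s] loc_frac_def[of _ _ n t] case_prod_unfold)
qed

end


section \<open>The polynomial module structure given by an endomorphism\<close>

definition poly_act ::
    "('k::field \<Rightarrow> 'v::ab_group_add \<Rightarrow> 'v) \<Rightarrow> ('v \<Rightarrow> 'v) \<Rightarrow> 'k poly \<Rightarrow> 'v \<Rightarrow> 'v" where
  "poly_act scale f p v = (\<Sum>i\<le>degree p. scale (coeff p i) ((f ^^ i) v))"

definition x_powers :: "'k::field poly set" where
  "x_powers = range (\<lambda>n. [:0, 1:] ^ n)"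

context
  fixes scale :: "'k::field \<Rightarrow> 'v::ab_group_add \<Rightarrow> 'v" and f :: "'v \<Rightarrow> 'v"
  assumes linear_f: "Vector_Spaces.linear scale scale f"
begin

interpretation f: Vector_Spaces.linear scale scale f
  by (rule linear_f)

lemma poly_act_altdef:
  assumes "degree p \<le> n"
  shows "poly_act scale f p v = (\<Sum>i\<le>n. scale (coeff p i) ((f ^^ i) v))"
  unfolding poly_act_def using assms
  by (intro sum.mono_neutral_left) (auto simp: coeff_eq_0 not_le)

lemma poly_act_0: "poly_act scale f 0 v = 0"
  by (simp add: poly_act_def)

lemma poly_act_pCons:
  "poly_act scale f (pCons a p) v = scale a v + f (poly_act scale f p v)"
proof -
  have "poly_act scale f (pCons a p) v =
      (\<Sum>i\<le>Suc (degree p). scale (coeff (pCons a p) i) ((f ^^ i) v))"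
    by (rule poly_act_altdef) (simp add: degree_pCons_le)
  also have "\<dots> = scale a v + f (poly_act scale f p v)"
    by (subst sum.atMost_Suc_shift) (simp add: poly_act_def f.sum f.scale)
  finally show ?thesis .
qed

lemma poly_act_x_power: "poly_act scale f ([:0, 1:] ^ n) v = (f ^^ n) v"
  by (induction n) (simp_all add: poly_act_pCons poly_act_0 one_pCons)

lemma module_poly_act: "module (poly_act scale f)"
proof
  fix p q :: "'k poly" and v w :: 'v
  show add: "poly_act scale f (p + q) v = poly_act scale f p v + poly_act scale f q v" for p q v
    by (subst (1 2 3) poly_act_altdef[where n = "max (degree p) (degree q)"])
       (auto simp: degree_add_le f.vs1.scale_left_distrib sum.distrib)
  show right: "poly_act scale f p (v + w) = poly_act scale f p v + poly_act scale f p w"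
    by (induction p)
       (simp_all add: poly_act_0 poly_act_pCons f.vs1.scale_right_distrib f.add add_ac)
  show "poly_act scale f 1 v = v"
    by (simp add: one_pCons poly_act_pCons poly_act_0)
  have smult: "poly_act scale f (smult a q) v = scale a (poly_act scale f q v)" for a q
    by (induction q) (simp_all add: poly_act_0 poly_act_pCons f.vs1.scale_right_distrib f.scale)
  show "poly_act scale f p (poly_act scale f q v) = poly_act scale f (p * q) v"
    by (induction p) (simp_all add: poly_act_0 poly_act_pCons add smult)
qed

lemma module_mult_set_poly_act: "module_mult_set (poly_act scale f) x_powers"
  by (intro module_mult_set.intro module_mult_set_axioms.intro module_poly_act)
     (auto simp: x_powers_def simp flip: power_add intro: range_eqI[of _ _ 0])

end


section \<open>Index and pointwise nilpotency\<close>

text \<open>\<open>\<infinity>\<close> encodes that no index exists.\<close>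

definition endo_index :: "('v::zero \<Rightarrow> 'v) \<Rightarrow> enat" where
  "endo_index f =
     (let stable = (\<lambda>m. 0 < m \<and> {v. (f ^^ m) v = 0} = {v. (f ^^ (m + 1)) v = 0} \<and>
                        range (f ^^ m) = range (f ^^ (m + 1)))
      in if bij f then 0 else if \<exists>m. stable m then enat (LEAST m. stable m) else \<infinity>)"

definition pointwise_nilpotent :: "('v::zero \<Rightarrow> 'v) \<Rightarrow> bool" where
  "pointwise_nilpotent f \<longleftrightarrow> (\<forall>v. \<exists>n. (f ^^ n) v = 0)"

end

theory Submission
  imports Defs
begin

text \<open>
  Write \<open>N\<close> for the kernel of the localization morphism, that is, the set of vectors killed by
  some power of \<open>\<phi>\<close>.  A section \<open>\<sigma>\<close> of a surjective localization morphism is the same as a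
  \<open>k[x]\<close>-submodule \<open>W\<close> complementary to \<open>N\<close>: the morphism restricts to an isomorphism
  \<open>W \<rightarrow> V\<^sub>x\<close>, whose inverse is \<open>\<sigma>\<close>, and \<open>W\<close> is the image of \<open>\<sigma>\<close>.  On \<open>N\<close> the
  endomorphism is pointwise nilpotent, on \<open>W \<cong> V\<^sub>x\<close> it is invertible because \<open>x\<close> is
  invertible on \<open>V\<^sub>x\<close>.

  Complements of this kind and decompositions \<open>\<phi> = \<phi>\<^sub>1 + \<phi>\<^sub>2\<close> determine each other.  Given
  \<open>V = N \<oplus> W\<close>, let \<open>\<phi>\<^sub>1\<close> be \<open>\<phi>\<close> on \<open>W\<close> and zero on \<open>N\<close>, and \<open>\<phi>\<^sub>2\<close> the other way round;
  with the projector \<open>v \<mapsto> \<sigma> (v/1)\<close> onto \<open>W\<close> this is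
  \<open>decomposition_of_loc_section\<close>.  Conversely, \<open>i(\<phi>\<^sub>1) \<le> 1\<close> says that
  \<open>V = Ker \<phi>\<^sub>1 \<oplus> Im \<phi>\<^sub>1\<close> with \<open>\<phi>\<^sub>1\<close> bijective on its image.  The vanishing of both
  compositions makes \<open>\<phi>\<close> agree with \<open>\<phi>\<^sub>2\<close> on \<open>Ker \<phi>\<^sub>1\<close> and with \<open>\<phi>\<^sub>1\<close> on \<open>Im \<phi>\<^sub>1\<close>,
  whence \<open>Ker \<phi>\<^sub>1 = N\<close> and \<open>W = Im \<phi>\<^sub>1\<close> is the wanted complement
  (\<open>loc_section_of_decomposition\<close>).
\<close>

context module_mult_set
begin

lemma loc_map_eq_iff:
  "loc_map scale S m = loc_map scale S n \<longleftrightarrow> (\<exists>u\<in>S. scale u m = scale u n)"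
  by (simp add: loc_map_def loc_frac_eq_iff one_closed)

lemma loc_map_in_carrier: "loc_map scale S m \<in> loc_carrier scale S"
  by (simp add: loc_map_def loc_frac_in_carrier one_closed)

lemma loc_add_map:
  "loc_add scale S (loc_map scale S m) (loc_map scale S n) = loc_map scale S (m + n)"
  by (simp add: loc_map_def loc_add_frac one_closed)

lemma loc_scale_map:
  "loc_scale scale S r (loc_map scale S m) = loc_map scale S (scale r m)"
  by (simp add: loc_map_def loc_scale_frac one_closed)

lemma loc_scale_cancel:
  assumes "s \<in> S"
  shows "loc_scale scale S s (loc_frac scale S m s) = loc_map scale S m"
  using assms one_closed by (auto simp: loc_scale_frac loc_map_def loc_frac_eq_iff)

text \<open>The inverse of a module isomorphism is again linear; here the isomorphism is the
  restriction of the localization morphism to a submodule.\<close>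

lemma loc_section_inv_into:
  assumes bij: "bij_betw (loc_map scale S) W (loc_carrier scale S)"
    and add: "\<And>v w. v \<in> W \<Longrightarrow> w \<in> W \<Longrightarrow> v + w \<in> W"
    and scale: "\<And>r v. v \<in> W \<Longrightarrow> scale r v \<in> W"
  shows "loc_section scale S (inv_into W (loc_map scale S))"
proof -
  let ?\<sigma> = "inv_into W (loc_map scale S)"
  have inv: "?\<sigma> (loc_map scale S w) = w" if "w \<in> W" for w
    using bij that by (simp add: bij_betw_inv_into_left)
  have cases: "\<exists>w\<in>W. A = loc_map scale S w" if "A \<in> loc_carrier scale S" for A
    using bij that by (auto simp: bij_betw_def)
  show ?thesis
    unfolding loc_section_def
  proof (intro conjI ballI allI)
    fix A B assume "A \<in> loc_carrier scale S" "B \<in> loc_carrier scale S"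
    then obtain v w where "v \<in> W" "w \<in> W" "A = loc_map scale S v" "B = loc_map scale S w"
      using cases by blast
    then show "?\<sigma> (loc_add scale S A B) = ?\<sigma> A + ?\<sigma> B"
      by (simp add: loc_add_map inv add)
  next
    fix r A assume "A \<in> loc_carrier scale S"
    then obtain w where "w \<in> W" "A = loc_map scale S w"
      using cases by blast
    then show "?\<sigma> (loc_scale scale S r A) = scale r (?\<sigma> A)"
      by (simp add: loc_scale_map inv scale)
  next
    fix A assume "A \<in> loc_carrier scale S"
    then obtain w where "w \<in> W" "A = loc_map scale S w"
      using cases by blast
    then show "loc_map scale S (?\<sigma> A) = A"
      by (simp add: inv)
  qed
qed

end

text \<open>The case \<open>i(f) = 0\<close> is absorbed: an automorphism satisfies the two equalities
  trivially.\<close>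

lemma endo_index_le_1_iff:
  assumes "f 0 = 0"
  shows "endo_index f \<le> 1 \<longleftrightarrow>
    (\<forall>v. f (f v) = 0 \<longrightarrow> f v = 0) \<and> range f = range (\<lambda>v. f (f v))"
proof -
  define stable where "stable = (\<lambda>m. 0 < m \<and> {v. (f ^^ m) v = 0} = {v. (f ^^ (m + 1)) v = 0} \<and>
                        range (f ^^ m) = range (f ^^ (m + 1)))"
  have index: "endo_index f =
      (if bij f then 0 else if \<exists>m. stable m then enat (LEAST m. stable m) else \<infinity>)"
    by (simp only: endo_index_def stable_def Let_def)
  have stable_1: "stable 1 \<longleftrightarrow>
      (\<forall>v. f (f v) = 0 \<longrightarrow> f v = 0) \<and> range f = range (\<lambda>v. f (f v))"
    using assms by (auto simp: stable_def comp_def)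
  show ?thesis
  proof (cases "bij f")
    case True
    then have "inj f" "surj f" by (auto simp: bij_def)
    then have "range (\<lambda>v. f (f v)) = UNIV"
      using comp_surj[of f f] by (simp add: comp_def)
    then have "stable 1"
      unfolding stable_1 using assms \<open>inj f\<close> \<open>surj f\<close> by (metis injD)
    then show ?thesis
      using True stable_1 by (simp add: index)
  next
    case False
    have "endo_index f \<le> 1 \<longleftrightarrow> stable 1"
    proof
      assume "endo_index f \<le> 1"
      with False obtain m where m: "stable m" and le: "(LEAST m. stable m) \<le> 1"
        by (auto simp: index one_enat_def split: if_splits)
      have "stable (LEAST m. stable m)"
        using m by (rule LeastI)
      moreover from this have "(LEAST m. stable m) = 1"
        using le by (auto simp: stable_def)
      ultimately show "stable 1" by simp
    next
      assume "stable 1"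
      then show "endo_index f \<le> 1"
        using False by (auto simp: index one_enat_def intro: Least_le)
    qed
    then show ?thesis
      by (simp only: stable_1)
  qed
qed

context
  fixes scale :: "'k::field \<Rightarrow> 'v::ab_group_add \<Rightarrow> 'v" and f :: "'v \<Rightarrow> 'v"
  assumes linear_f: "Vector_Spaces.linear scale scale f"
begin

interpretation f: Vector_Spaces.linear scale scale f
  by (rule linear_f)

interpretation loc: module_mult_set "poly_act scale f" x_powers
  by (rule module_mult_set_poly_act[OF linear_f])

lemma poly_act_const: "poly_act scale f [:a:] v = scale a v"
  by (simp add: poly_act_pCons[OF linear_f] poly_act_0[OF linear_f])

lemma poly_act_X: "poly_act scale f [:0, 1:] v = f v"
  using poly_act_x_power[OF linear_f, of 1] by simp

lemma poly_loc_map_eq_iff: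
  "loc_map (poly_act scale f) x_powers v = loc_map (poly_act scale f) x_powers w \<longleftrightarrow>
    (\<exists>n. (f ^^ n) (v - w) = 0)"
  unfolding loc.loc_map_eq_iff
  by (simp add: x_powers_def loc.scale_right_diff_distrib
      flip: poly_act_x_power[OF linear_f])

text \<open>The projector \<open>P v = \<sigma> (v/1)\<close> onto the image of \<open>\<sigma>\<close> has the kernel of the localization
  morphism as its kernel and commutes with \<open>f\<close>, so \<open>f P\<close> and \<open>f (1 - P)\<close> are the two parts.\<close>

lemma decomposition_of_loc_section:
  assumes sec: "loc_section (poly_act scale f) x_powers \<sigma>"
  shows "\<exists>g h. Vector_Spaces.linear scale scale g \<and> Vector_Spaces.linear scale scale h \<and>
       f = (\<lambda>v. g v + h v) \<and> endo_index g \<le> 1 \<and> pointwise_nilpotent h \<and>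
       g \<circ> h = (\<lambda>v. 0) \<and> h \<circ> g = (\<lambda>v. 0)"
proof -
  let ?act = "poly_act scale f"
  let ?loc = "loc_map ?act x_powers"
  define P where "P v = \<sigma> (?loc v)" for v
  define g where "g v = f (P v)" for v
  define h where "h v = f v - f (P v)" for v
  have \<sigma>_scale: "\<sigma> (loc_scale ?act x_powers r A) = ?act r (\<sigma> A)"
    and loc_\<sigma>: "?loc (\<sigma> A) = A" if "A \<in> loc_carrier ?act x_powers" for r A
    using sec that by (auto simp: loc_section_def)
  have P_add: "P (v + w) = P v + P w" for v w
    using sec loc.loc_map_in_carrier by (simp add: P_def loc_section_def flip: loc.loc_add_map)
  have P_act: "P (?act r v) = ?act r (P v)" for r v
    by (simp add: P_def \<sigma>_scale loc.loc_map_in_carrier flip: loc.loc_scale_map)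
  have P_scale: "P (scale a v) = scale a (P v)" for a v
    using P_act[of "[:a:]"] by (simp add: poly_act_const)
  have P_f: "P (f v) = f (P v)" for v
    using P_act[of "[:0, 1:]"] by (simp add: poly_act_X)
  have P_0: "P 0 = 0"
    using P_add[of 0 0] by simp
  have P_diff: "P (v - w) = P v - P w" for v w
    using P_add[of "v - w" w] by (simp add: algebra_simps)
  have loc_P: "?loc (P v) = ?loc v" for v
    by (simp add: P_def loc_\<sigma> loc.loc_map_in_carrier)
  have P_P: "P (P v) = P v" for v
    by (simp add: P_def[of "P v"] loc_P) (simp add: P_def)
  have P_eq_0_iff: "P v = 0 \<longleftrightarrow> (\<exists>n. (f ^^ n) v = 0)" for v
  proof -
    have "P v = 0 \<longleftrightarrow> ?loc v = ?loc 0"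
    proof
      assume "P v = 0"
      then show "?loc v = ?loc 0" using loc_P[of v] by simp
    next
      assume "?loc v = ?loc 0"
      then show "P v = 0" using P_0 by (simp add: P_def)
    qed
    then show ?thesis by (simp add: poly_loc_map_eq_iff)
  qed
  have lin_g: "Vector_Spaces.linear scale scale g"
    by unfold_locales (simp_all add: g_def P_add P_scale f.add f.scale)
  have lin_h: "Vector_Spaces.linear scale scale h"
    by unfold_locales
      (simp_all add: h_def P_add P_scale f.add f.scale f.vs1.scale_right_diff_distrib)
  have g_g: "g (g v) = f (f (P v))" for v
    by (simp add: g_def P_f P_P)
  have index: "endo_index g \<le> 1"
  proof (subst endo_index_le_1_iff, simp add: g_def P_0 f.zero, intro conjI allI impI)
    fix v assume "g (g v) = 0"
    then have "(f ^^ 2) (P v) = 0"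
      by (simp add: g_g numeral_2_eq_2)
    then have "P v = 0"
      using P_eq_0_iff[of "P v"] P_P by auto
    then show "g v = 0"
      by (simp add: g_def f.zero)
  next
    have "\<exists>w. g v = g (g w)" for v
    proof -
      \<comment> \<open>The fraction \<open>v/x\<close> provides a preimage of \<open>P v\<close> under \<open>f\<close> in the image of \<open>P\<close>.\<close>
      let ?A = "loc_frac ?act x_powers v [:0, 1:]"
      have X: "[:0, 1:] \<in> (x_powers :: 'k poly set)"
        unfolding x_powers_def by (rule range_eqI[of _ _ 1]) simp
      have A: "?A \<in> loc_carrier ?act x_powers"
        by (rule loc.loc_frac_in_carrier[OF X])
      have "f (P (\<sigma> ?A)) = f (\<sigma> ?A)"
        by (simp add: P_def loc_\<sigma>[OF A])
      also have "\<dots> = P v"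
        using \<sigma>_scale[OF A, of "[:0, 1:]"]
        by (simp add: poly_act_X loc.loc_scale_cancel[OF X] P_def)
      finally have "g (g (\<sigma> ?A)) = g v"
        by (simp add: g_g) (simp add: g_def)
      then show ?thesis by metis
    qed
    then show "range g = range (\<lambda>v. g (g v))"
      by auto
  qed
  have P_h: "P (h v) = 0" for v
    by (simp add: h_def P_diff P_f P_P)
  have h_pow: "(h ^^ n) v = (f ^^ n) v" if "P v = 0" for n v
    using that by (induction n arbitrary: v) (simp_all add: funpow_Suc_right P_f h_def f.zero del: funpow.simps(2))
  have nilp: "pointwise_nilpotent h"
    unfolding pointwise_nilpotent_def
  proof
    fix v
    obtain n where "(f ^^ n) (h v) = 0"
      using P_eq_0_iff P_h by blast
    then have "(h ^^ Suc n) v = 0"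
      by (simp add: funpow_Suc_right h_pow P_h del: funpow.simps(2))
    then show "\<exists>n. (h ^^ n) v = 0" ..
  qed
  have "g (h v) = 0" "h (g v) = 0" for v
    by (simp_all add: g_def P_h f.zero) (simp add: h_def P_f P_P)
  then have "g \<circ> h = (\<lambda>v. 0)" "h \<circ> g = (\<lambda>v. 0)"
    by auto
  moreover have "f = (\<lambda>v. g v + h v)"
    by (simp add: g_def h_def)
  ultimately show ?thesis
    using lin_g lin_h index nilp by blast
qed

text \<open>On the kernel of \<open>g\<close> the endomorphism \<open>f\<close> acts as \<open>h\<close>, so the localization morphism
  kills it; on the image of \<open>g\<close> it acts as \<open>g\<close>, which is injective there, so the localization
  morphism is injective too.  As the two subspaces span the whole space, the image of \<open>g\<close> hits
  every fraction \<open>v/1\<close>, and by surjectivity every fraction.\<close>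

lemma loc_section_of_decomposition:
  assumes surj: "range (loc_map (poly_act scale f) x_powers)
      = loc_carrier (poly_act scale f) x_powers"
    and lin_g: "Vector_Spaces.linear scale scale g"
    and f_eq: "\<And>v. f v = g v + h v"
    and index: "endo_index g \<le> 1" and nilp: "pointwise_nilpotent h"
    and gh: "\<And>v. g (h v) = 0" and hg: "\<And>v. h (g v) = 0"
  shows "loc_section (poly_act scale f) x_powers
    (inv_into (range g) (loc_map (poly_act scale f) x_powers))"
proof -
  interpret g: Vector_Spaces.linear scale scale g
    by (rule lin_g)
  let ?act = "poly_act scale f"
  let ?loc = "loc_map ?act x_powers"
  have ker: "g (g v) = 0 \<Longrightarrow> g v = 0" and im: "range g = range (\<lambda>v. g (g v))" for v
    using index by (auto simp: endo_index_le_1_iff g.zero)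
  have f_g: "f (g v) = g (g v)" for v
    by (simp add: f_eq hg)
  have ker_nilp: "\<exists>n. (f ^^ n) v = 0" if "g v = 0" for v
  proof -
    have "(f ^^ n) v = (h ^^ n) v \<and> g ((h ^^ n) v) = 0" for n
      using that by (induction n) (simp_all add: f_eq gh)
    then show ?thesis
      using nilp by (auto simp: pointwise_nilpotent_def)
  qed
  have im_inj: "w = 0" if "w \<in> range g" "(f ^^ n) w = 0" for n w
    using that
  proof (induction n arbitrary: w)
    case (Suc n)
    from Suc.prems(1) obtain u where u: "w = g u" by auto
    have "f w = 0"
    proof (rule Suc.IH)
      show "f w \<in> range g"
        by (simp add: u f_g)
      show "(f ^^ n) (f w) = 0"
        using Suc.prems(2) by (simp add: funpow_Suc_right del: funpow.simps(2))
    qed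
    then show ?case
      using ker by (simp add: u f_g)
  qed simp
  have inj: "inj_on ?loc (range g)"
  proof (rule inj_onI)
    fix v w assume "v \<in> range g" "w \<in> range g" "?loc v = ?loc w"
    then obtain n where "v - w \<in> range g" "(f ^^ n) (v - w) = 0"
      by (auto simp: poly_loc_map_eq_iff simp flip: g.diff)
    then show "v = w"
      using im_inj by fastforce
  qed
  have "?loc v \<in> ?loc ` range g" for v
  proof -
    \<comment> \<open>With \<open>g v = g (g w)\<close>, the component of \<open>v\<close> in the image of \<open>g\<close> is \<open>g w\<close>.\<close>
    obtain w where "g v = g (g w)"
      using im by (metis (no_types, lifting) imageE rangeI)
    then have "?loc v = ?loc (g w)"
      by (auto simp: poly_loc_map_eq_iff g.diff intro: ker_nilp)
    then show ?thesis by auto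
  qed
  then have "?loc ` range g = range ?loc" by auto
  with inj surj have bij: "bij_betw ?loc (range g) (loc_carrier ?act x_powers)"
    by (simp add: bij_betw_def)
  have add: "v + w \<in> range g" if "v \<in> range g" "w \<in> range g" for v w
    using that by (auto simp flip: g.add)
  have "?act p v \<in> range g" if "v \<in> range g" for p v
  proof (induction p)
    case 0
    then show ?case
      by (auto simp: poly_act_0[OF linear_f] intro: range_eqI[of _ _ 0] simp: g.zero)
  next
    case (pCons a p)
    have "scale a v \<in> range g"
      using that by (auto simp flip: g.scale)
    moreover have "f (?act p v) \<in> range g"
      using pCons.IH by (auto simp: f_g)
    ultimately show ?case
      by (simp add: poly_act_pCons[OF linear_f] add)
  qed
  with bij add show ?thesis
    by (rule loc.loc_section_inv_into)
qed

end

theorem corollary3p9: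
  fixes scale :: "'k::field \<Rightarrow> 'v::ab_group_add \<Rightarrow> 'v" and \<phi> :: "'v \<Rightarrow> 'v"
  assumes "vector_space scale"
    and "Vector_Spaces.linear scale scale \<phi>"
    and "loc_map (poly_act scale \<phi>) x_powers ` UNIV = loc_carrier (poly_act scale \<phi>) x_powers"
  shows "(\<exists>\<sigma>. loc_section (poly_act scale \<phi>) x_powers \<sigma>) \<longleftrightarrow>
    (\<exists>\<phi>\<^sub>1 \<phi>\<^sub>2. Vector_Spaces.linear scale scale \<phi>\<^sub>1 \<and> Vector_Spaces.linear scale scale \<phi>\<^sub>2 \<and>
       \<phi> = (\<lambda>v. \<phi>\<^sub>1 v + \<phi>\<^sub>2 v) \<and>
       endo_index \<phi>\<^sub>1 \<le> 1 \<and>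
       pointwise_nilpotent \<phi>\<^sub>2 \<and>
       \<phi>\<^sub>1 \<circ> \<phi>\<^sub>2 = (\<lambda>v. 0) \<and> \<phi>\<^sub>2 \<circ> \<phi>\<^sub>1 = (\<lambda>v. 0))"
    (is "?section \<longleftrightarrow> ?decomposition")
proof
  assume ?section
  then show ?decomposition
    using decomposition_of_loc_section[OF assms(2)] by blast
next
  assume ?decomposition
  then obtain \<phi>\<^sub>1 \<phi>\<^sub>2 where lin: "Vector_Spaces.linear scale scale \<phi>\<^sub>1"
    and eq: "\<phi> = (\<lambda>v. \<phi>\<^sub>1 v + \<phi>\<^sub>2 v)"
    and parts: "endo_index \<phi>\<^sub>1 \<le> 1" "pointwise_nilpotent \<phi>\<^sub>2"
    and comp: "\<phi>\<^sub>1 \<circ> \<phi>\<^sub>2 = (\<lambda>v. 0)" "\<phi>\<^sub>2 \<circ> \<phi>\<^sub>1 = (\<lambda>v. 0)"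
    by blast
  show ?section
    using loc_section_of_decomposition[OF assms(2,3) lin fun_cong[OF eq] parts]
      fun_cong[OF comp(1)] fun_cong[OF comp(2)] by auto
qed

end
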